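(* Let $L$ and $M$ be $\kappa$-frames and let $\varphi:\mathfrak{C}L\to M$ be a $\kappa$-frame homomorphism. Then $\mathrm{cl}(\ker\varphi)=\widetilde\nabla_{\ker(\varphi\circ\nabla_\bullet)}$.
   Context: Here $\kappa$ is either an infinite regular cardinal or the symbol $\infty$. A $\kappa$-set is a set of cardinality less than $\kappa$ (any set if $\kappa=\infty$). A $\kappa$-frame is a bounded distributive lattice with joins of all $\kappa$-sets, over which binary meets distribute; for $\kappa=\infty$ this is a frame. Homomorphisms preserve finite meets and $\kappa$-joins (joins of $\kappa$-sets). A congruence on a $\kappa$-frame $N$ is an equivalence relation on $N$ closed under finite meets and $\kappa$-joins in $N\times N$; congruences are ordered by inclusion. The kernel of a homomorphism $f$ is the congruence $\{(x,y)\mid f(x)=f(y)\}$. $\mathfrak{C}L$ denotes the $\kappa$-frame of those congruences on $L$ generated by a $\kappa$-set of pairs (all congruences if $\kappa=\infty$), ordered by inclusion. For $a\in L$, $\nabla_a$ is the congruence on $L$ generated by $(0,a)$, and $\nabla_\bullet:L\to\mathfrak{C}L$, $a\mapsto\nabla_a$, is an injective $\kappa$-frame homomorphism. For a congruence $D$ on a $\kappa$-frame $N$, the (generalised) closure $\mathrm{cl}(D)$ is the largest generalised closed congruence contained in $D$, where a congruence is generalised closed if it is a join of congruences of the form $\langle(0,n)\rangle$, $n\in N$. Here this is applied to $N=\mathfrak{C}L$. For a congruence $C$ on $L$, $\widetilde\nabla_C$ denotes the congruence on $\mathfrak{C}L$ generated by $\{(\nabla_a,\nabla_b)\mid(a,b)\in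 C\}$ (equivalently, the join of the congruences $\langle(0,A)\rangle$ on $\mathfrak{C}L$ for $A\in\mathfrak{C}L$, $A\le C$). *)

theory Defs
  imports Main "HOL-Algebra.Lattice"
begin

unbundle cardinal_syntax

section \<open>The parameter kappa\<close>

text \<open>
  \<open>Unbounded\<close> stands for the symbol \<open>\<infinity>\<close>. The argument of \<open>Regular\<close> is a cardinal in the sense
  of \<open>Card_order\<close>, over a type unrelated to those of the frames.
\<close>

datatype 'k kappa = Regular "'k rel" | Unbounded

fun kappa_ok :: "'k kappa \<Rightarrow> bool" where
  "kappa_ok (Regular r) \<longleftrightarrow> Card_order r \<and> cinfinite r \<and> regularCard r"
| "kappa_ok Unbounded \<longleftrightarrow> True"

fun kappa_set :: "'k kappa \<Rightarrow> 'a set \<Rightarrow> bool" where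
  "kappa_set (Regular r) A \<longleftrightarrow> |A| <o r"
| "kappa_set Unbounded A \<longleftrightarrow> True"


section \<open>Frames and homomorphisms\<close>

locale kappa_frame = bounded_lattice L
  for \<kappa> :: "'k kappa" and L :: "('a, 'c) gorder_scheme" (structure) +
  assumes distrib: "\<lbrakk>x \<in> carrier L; y \<in> carrier L; z \<in> carrier L\<rbrakk> \<Longrightarrow>
      x \<sqinter> (y \<squnion> z) = (x \<sqinter> y) \<squnion> (x \<sqinter> z)"
    and kappa_sup_exists: "\<lbrakk>A \<subseteq> carrier L; kappa_set \<kappa> A\<rbrakk> \<Longrightarrow> \<exists>s. least L s (Upper L A)"
    and kappa_distrib: "\<lbrakk>x \<in> carrier L; A \<subseteq> carrier L; kappa_set \<kappa> A\<rbrakk> \<Longrightarrow>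
      x \<sqinter> \<Squnion>A = \<Squnion>((\<lambda>a. x \<sqinter> a) ` A)"

text \<open>Preservation of the bottom element is the case \<open>A = {}\<close> of the last clause.\<close>

definition kappa_hom ::
  "'k kappa \<Rightarrow> ('a, 'c) gorder_scheme \<Rightarrow> ('b, 'd) gorder_scheme \<Rightarrow> ('a \<Rightarrow> 'b) \<Rightarrow> bool" where
  "kappa_hom \<kappa> L M f \<longleftrightarrow>
     f \<in> carrier L \<rightarrow> carrier M \<and>
     f \<top>\<^bsub>L\<^esub> = \<top>\<^bsub>M\<^esub> \<and>
     (\<forall>x\<in>carrier L. \<forall>y\<in>carrier L. f (x \<sqinter>\<^bsub>L\<^esub> y) = f x \<sqinter>\<^bsub>M\<^esub> f y) \<and>
     (\<forall>A. A \<subseteq> carrier L \<and> kappa_set \<kappa> A \<longrightarrow> f (\<Squnion>\<^bsub>L\<^esub>A) = \<Squnion>\<^bsub>M\<^esub>(f ` A))"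


section \<open>Congruences\<close>

text \<open>
  Meets and joins in \<open>N \<times> N\<close> are computed componentwise. The empty meet, that is the pair
  \<open>(\<top>, \<top>)\<close>, belongs to every equivalence relation on the carrier.
\<close>

definition kappa_congruence :: "'k kappa \<Rightarrow> ('a, 'c) gorder_scheme \<Rightarrow> 'a rel \<Rightarrow> bool" where
  "kappa_congruence \<kappa> N D \<longleftrightarrow>
     equiv (carrier N) D \<and>
     (\<forall>x y x' y'. (x, y) \<in> D \<and> (x', y') \<in> D \<longrightarrow> (x \<sqinter>\<^bsub>N\<^esub> x', y \<sqinter>\<^bsub>N\<^esub> y') \<in> D) \<and>
     (\<forall>S. S \<subseteq> D \<and> kappa_set \<kappa> S \<longrightarrow> (\<Squnion>\<^bsub>N\<^esub>(fst ` S), \<Squnion>\<^bsub>N\<^esub>(snd ` S)) \<in> D)"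

definition cong_gen :: "'k kappa \<Rightarrow> ('a, 'c) gorder_scheme \<Rightarrow> 'a rel \<Rightarrow> 'a rel" where
  "cong_gen \<kappa> N S = \<Inter>{D. kappa_congruence \<kappa> N D \<and> S \<subseteq> D}"

definition hom_kernel :: "('a, 'c) gorder_scheme \<Rightarrow> ('a \<Rightarrow> 'b) \<Rightarrow> 'a rel" where
  "hom_kernel N f = {(x, y). x \<in> carrier N \<and> y \<in> carrier N \<and> f x = f y}"

text \<open>
  For \<open>\<kappa> = Unbounded\<close> the two carriers agree, since a congruence is generated by itself.
\<close>

definition all_cong :: "'k kappa \<Rightarrow> ('a, 'c) gorder_scheme \<Rightarrow> 'a rel gorder" where
  "all_cong \<kappa> N = \<lparr>carrier = {D. kappa_congruence \<kappa> N D}, eq = (=), le = (\<subseteq>)\<rparr>"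

definition cong_frame :: "'k kappa \<Rightarrow> ('a, 'c) gorder_scheme \<Rightarrow> 'a rel gorder" where
  "cong_frame \<kappa> N =
     \<lparr>carrier = {cong_gen \<kappa> N S | S. S \<subseteq> carrier N \<times> carrier N \<and> kappa_set \<kappa> S},
      eq = (=), le = (\<subseteq>)\<rparr>"

definition nabla :: "'k kappa \<Rightarrow> ('a, 'c) gorder_scheme \<Rightarrow> 'a \<Rightarrow> 'a rel" where
  "nabla \<kappa> N a = cong_gen \<kappa> N {(\<bottom>\<^bsub>N\<^esub>, a)}"


section \<open>Generalised closure\<close>

text \<open>The join is over an arbitrary family, also when \<open>\<kappa>\<close> is a cardinal. The greatest
  element taken in \<open>gen_closure\<close> therefore exists: it is the join of all \<open>nabla \<kappa> N n\<close> contained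
  in the congruence \<open>D\<close>.\<close>

definition gen_closed :: "'k kappa \<Rightarrow> ('a, 'c) gorder_scheme \<Rightarrow> 'a rel \<Rightarrow> bool" where
  "gen_closed \<kappa> N D \<longleftrightarrow> (\<exists>A \<subseteq> carrier N. D = \<Squnion>\<^bsub>all_cong \<kappa> N\<^esub>(nabla \<kappa> N ` A))"

definition gen_closure :: "'k kappa \<Rightarrow> ('a, 'c) gorder_scheme \<Rightarrow> 'a rel \<Rightarrow> 'a rel" where
  "gen_closure \<kappa> N D = (GREATEST E. gen_closed \<kappa> N E \<and> E \<subseteq> D)"

definition nabla_tilde :: "'k kappa \<Rightarrow> ('a, 'c) gorder_scheme \<Rightarrow> 'a rel \<Rightarrow> 'a rel rel" where
  "nabla_tilde \<kappa> L C =
     cong_gen \<kappa> (cong_frame \<kappa> L) {(nabla \<kappa> L a, nabla \<kappa> L b) | a b. (a, b) \<in> C}"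

end

theory Submission
  imports Defs
begin

text \<open>
  Write \<open>CL\<close> for the frame of congruences of \<open>L\<close> and \<open>\<langle>a, b\<rangle>\<close> for the principal congruence
  generated by \<open>(a, b)\<close>. The theorem is a statement about an arbitrary congruence \<open>K\<close> on \<open>CL\<close>,
  of which the kernel of \<open>\<phi>\<close> is an instance: the closure of \<open>K\<close> is generated by the pairs
  \<open>(\<nabla>\<^sub>a, \<nabla>\<^sub>b)\<close> that belong to \<open>K\<close> (lemma \<open>gen_closure_eq_gen_nabla_pairs\<close>).

  The closure of \<open>K\<close> is generated by the pairs \<open>(\<bottom>, A)\<close> in \<open>K\<close> (\<open>gen_closure_eq_cong_gen\<close>), so two
  sets of generators have to be compared. The bridge is \<open>nabla_pair_iff_principal\<close>: for \<open>a \<le> b\<close> and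
  any congruence \<open>D\<close> on \<open>CL\<close>, the pair \<open>(\<nabla>\<^sub>a, \<nabla>\<^sub>b)\<close> lies in \<open>D\<close> iff \<open>(\<bottom>, \<langle>a, b\<rangle>)\<close> does. Indeed
  \<open>\<nabla>\<^sub>a \<sqinter> \<langle>a, b\<rangle> = \<bottom>\<close> and \<open>\<nabla>\<^sub>a \<squnion> \<langle>a, b\<rangle> = \<nabla>\<^sub>b\<close>, so one passes between the two pairs by taking
  the meet with \<open>\<langle>a, b\<rangle>\<close> and the join with \<open>\<nabla>\<^sub>a\<close>. If \<open>(\<bottom>, A)\<close> lies in \<open>K\<close>, then so does
  \<open>(\<bottom>, \<langle>a, b\<rangle>)\<close> for each \<open>(a, b)\<close> in a \<open>\<kappa>\<close>-set generating \<open>A\<close>, which may be taken with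
  \<open>a \<le> b\<close>; the bridge and one \<open>\<kappa>\<close>-join then recover \<open>(\<bottom>, A)\<close> from the pairs \<open>(\<nabla>\<^sub>a, \<nabla>\<^sub>b)\<close>. Conversely,
  \<open>(\<nabla>\<^sub>a, \<nabla>\<^sub>b)\<close> in \<open>K\<close> gives \<open>(\<nabla>\<^sub>a, \<nabla>\<^bsub>a\<squnion>b\<^esub>)\<close> and \<open>(\<nabla>\<^sub>b, \<nabla>\<^bsub>a\<squnion>b\<^esub>)\<close> in \<open>K\<close>, to which the bridge
  applies.

  The preparation for this is that \<open>CL\<close> has the lattice operations one expects. Joins are generated
  by unions, by regularity of \<open>\<kappa>\<close>. Meets are intersections, which requires the intersection of two
  \<open>\<kappa>\<close>-generated congruences to be \<open>\<kappa>\<close>-generated; explicit generators are given in \<open>cong_gen_Int\<close>.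
\<close>

section \<open>Kappa-sets\<close>

lemma kappa_set_finite:
  assumes "kappa_ok \<kappa>" "finite A"
  shows "kappa_set \<kappa> A"
proof (cases \<kappa>)
  case (Regular r)
  then have r: "Card_order r" "infinite (Field r)"
    using assms by (auto simp: cinfinite_def)
  then have "Well_order r"
    by (auto dest: card_order_on_well_order_on)
  then have "|A| <o r"
    by (rule finite_ordLess_infinite[OF card_of_Well_order]) (use assms r in \<open>auto simp: Field_card_of\<close>)
  with Regular show ?thesis by simp
qed simp

lemma kappa_set_image: "kappa_set \<kappa> A \<Longrightarrow> kappa_set \<kappa> (f ` A)"
  by (cases \<kappa>) (auto intro: ordLeq_ordLess_trans card_of_image)

lemma kappa_set_UN:
  assumes "kappa_ok \<kappa>" "kappa_set \<kappa> I" "\<And>i. i \<in> I \<Longrightarrow> kappa_set \<kappa> (A i)"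
  shows "kappa_set \<kappa> (\<Union>i\<in>I. A i)"
proof (cases \<kappa>)
  case (Regular r)
  then have "stable r"
    using assms(1) by (auto simp: cinfinite_def intro: regularCard_stable)
  with Regular assms show ?thesis
    by (auto intro: stable_UNION)
qed simp

lemma kappa_set_insert:
  assumes "kappa_ok \<kappa>" "kappa_set \<kappa> A"
  shows "kappa_set \<kappa> (insert x A)"
proof -
  have "kappa_set \<kappa> (\<Union>b\<in>{True, False}. if b then A else {x})"
    by (rule kappa_set_UN) (use assms in \<open>auto intro: kappa_set_finite\<close>)
  then show ?thesis by simp
qed


section \<open>Generated congruences and their generalised closure\<close>

lemma kappa_congruenceD:
  assumes "kappa_congruence \<kappa> N D"
  shows kc_carrier: "(x, y) \<in> D \<Longrightarrow> x \<in> carrier N \<and> y \<in> carrier N"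
    and kc_refl: "x \<in> carrier N \<Longrightarrow> (x, x) \<in> D"
    and kc_sym: "(x, y) \<in> D \<Longrightarrow> (y, x) \<in> D"
    and kc_trans: "(x, y) \<in> D \<Longrightarrow> (y, z) \<in> D \<Longrightarrow> (x, z) \<in> D"
    and kc_meet: "(x, y) \<in> D \<Longrightarrow> (x', y') \<in> D \<Longrightarrow> (x \<sqinter>\<^bsub>N\<^esub> x', y \<sqinter>\<^bsub>N\<^esub> y') \<in> D"
    and kc_sup: "S \<subseteq> D \<Longrightarrow> kappa_set \<kappa> S \<Longrightarrow> (\<Squnion>\<^bsub>N\<^esub>(fst ` S), \<Squnion>\<^bsub>N\<^esub>(snd ` S)) \<in> D"
proof -
  have D: "equiv (carrier N) D"
    using assms by (simp add: kappa_congruence_def)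
  then show "(x, y) \<in> D \<Longrightarrow> x \<in> carrier N \<and> y \<in> carrier N"
    using equiv_type by blast
  from D show "x \<in> carrier N \<Longrightarrow> (x, x) \<in> D"
    by (simp add: equiv_def refl_on_def)
  from D show "(x, y) \<in> D \<Longrightarrow> (y, x) \<in> D"
    by (meson equivE symE)
  from D show "(x, y) \<in> D \<Longrightarrow> (y, z) \<in> D \<Longrightarrow> (x, z) \<in> D"
    by (meson equivE transE)
qed (use assms in \<open>simp_all add: kappa_congruence_def\<close>)

lemma kc_join:
  assumes "kappa_ok \<kappa>" "kappa_congruence \<kappa> N D" "(x, y) \<in> D" "(x', y') \<in> D"
  shows "(x \<squnion>\<^bsub>N\<^esub> x', y \<squnion>\<^bsub>N\<^esub> y') \<in> D"
  using kc_sup[OF assms(2), of "{(x, y), (x', y')}"] assms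
  by (simp add: join_def kappa_set_finite)

lemma kappa_congruenceI:
  assumes "D \<subseteq> carrier N \<times> carrier N"
    and "\<And>x. x \<in> carrier N \<Longrightarrow> (x, x) \<in> D"
    and "\<And>x y. (x, y) \<in> D \<Longrightarrow> (y, x) \<in> D"
    and "\<And>x y z. (x, y) \<in> D \<Longrightarrow> (y, z) \<in> D \<Longrightarrow> (x, z) \<in> D"
    and "\<And>x y x' y'. (x, y) \<in> D \<Longrightarrow> (x', y') \<in> D \<Longrightarrow> (x \<sqinter>\<^bsub>N\<^esub> x', y \<sqinter>\<^bsub>N\<^esub> y') \<in> D"
    and "\<And>S. S \<subseteq> D \<Longrightarrow> kappa_set \<kappa> S \<Longrightarrow> (\<Squnion>\<^bsub>N\<^esub>(fst ` S), \<Squnion>\<^bsub>N\<^esub>(snd ` S)) \<in> D"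
  shows "kappa_congruence \<kappa> N D"
  unfolding kappa_congruence_def
proof (intro conjI allI impI)
  show "equiv (carrier N) D"
    by (intro equivI refl_onI symI transI) (use assms(1-4) in blast)+
qed (use assms(5,6) in auto)

lemma cong_gen_incl: "S \<subseteq> cong_gen \<kappa> N S"
  by (auto simp: cong_gen_def)

lemma cong_gen_mono: "S \<subseteq> T \<Longrightarrow> cong_gen \<kappa> N S \<subseteq> cong_gen \<kappa> N T"
  by (auto simp: cong_gen_def)

lemma cong_gen_least: "kappa_congruence \<kappa> N D \<Longrightarrow> S \<subseteq> D \<Longrightarrow> cong_gen \<kappa> N S \<subseteq> D"
  by (auto simp: cong_gen_def)

text \<open>
  The intersection defining the generated congruence must be taken over a nonempty family. The total
  relation serves as a member: that it is a congruence says just that \<open>N\<close> is closed under its meets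
  and \<open>\<kappa>\<close>-joins.
\<close>

lemma cong_gen_congruence:
  assumes total: "kappa_congruence \<kappa> N (carrier N \<times> carrier N)"
    and S: "S \<subseteq> carrier N \<times> carrier N"
  shows "kappa_congruence \<kappa> N (cong_gen \<kappa> N S)"
proof (rule kappa_congruenceI)
  show "cong_gen \<kappa> N S \<subseteq> carrier N \<times> carrier N"
    by (rule cong_gen_least) fact+
next
  fix R assume "R \<subseteq> cong_gen \<kappa> N S" and R: "kappa_set \<kappa> R"
  then have "R \<subseteq> D" if "kappa_congruence \<kappa> N D" "S \<subseteq> D" for D
    using that by (auto simp: cong_gen_def)
  with R show "(\<Squnion>\<^bsub>N\<^esub>(fst ` R), \<Squnion>\<^bsub>N\<^esub>(snd ` R)) \<in> cong_gen \<kappa> N S"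
    unfolding cong_gen_def by (blast intro: kc_sup)
next
  fix x y z assume "(x, y) \<in> cong_gen \<kappa> N S" "(y, z) \<in> cong_gen \<kappa> N S"
  then show "(x, z) \<in> cong_gen \<kappa> N S"
    by (auto simp: cong_gen_def dest: kc_trans)
qed (auto simp: cong_gen_def intro: kc_refl kc_sym kc_meet)

lemma cong_gen_id: "kappa_congruence \<kappa> N D \<Longrightarrow> cong_gen \<kappa> N D = D"
  using cong_gen_least[of \<kappa> N D D] cong_gen_incl[of D \<kappa> N] by blast

lemma sup_inclusion_eqI:
  assumes "s \<in> X" "\<And>A. A \<in> F \<Longrightarrow> A \<subseteq> s" "F \<subseteq> X"
    and "\<And>t. t \<in> X \<Longrightarrow> (\<And>A. A \<in> F \<Longrightarrow> A \<subseteq> t) \<Longrightarrow> s \<subseteq> t"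
  shows "\<Squnion>\<^bsub>\<lparr>carrier = X, eq = (=), le = (\<subseteq>)\<rparr>\<^esub> F = s"
  unfolding sup_def
proof (rule some_equality)
  let ?P = "\<lparr>carrier = X, eq = (=), le = (\<subseteq>)\<rparr>"
  have iff: "u \<in> Upper ?P F \<longleftrightarrow> u \<in> X \<and> (\<forall>A\<in>F. A \<subseteq> u)" for u
    using assms(3) by (auto simp: Upper_def)
  show s: "least ?P s (Upper ?P F)"
    unfolding least_def
  proof (intro conjI ballI)
    show "s \<in> Upper ?P F" unfolding iff using assms(1,2) by blast
    show "s \<sqsubseteq>\<^bsub>?P\<^esub> t" if "t \<in> Upper ?P F" for t
      using that assms(4)[of t] unfolding iff by simp
  qed (simp add: Upper_def)
  show "u = s" if "least ?P u (Upper ?P F)" for u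
    using that s unfolding least_def by (simp add: subset_antisym)
qed

lemma meet_inclusion_eq:
  assumes "A \<in> X" "B \<in> X" "A \<inter> B \<in> X"
  shows "A \<sqinter>\<^bsub>\<lparr>carrier = X, eq = (=), le = (\<subseteq>)\<rparr>\<^esub> B = A \<inter> B"
  unfolding inf_def meet_def
proof (rule some_equality)
  let ?P = "\<lparr>carrier = X, eq = (=), le = (\<subseteq>)\<rparr>"
  have iff: "u \<in> Lower ?P {A, B} \<longleftrightarrow> u \<in> X \<and> u \<subseteq> A \<inter> B" for u
    using assms by (auto simp: Lower_def)
  show s: "greatest ?P (A \<inter> B) (Lower ?P {A, B})"
    using assms unfolding greatest_def iff by (simp add: Lower_def)
  show "u = A \<inter> B" if "greatest ?P u (Lower ?P {A, B})" for u
    using that s unfolding greatest_def by (simp add: subset_antisym)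
qed

lemma bottom_inclusion_eqI:
  assumes "s \<in> X" "\<And>t. t \<in> X \<Longrightarrow> s \<subseteq> t"
  shows "\<bottom>\<^bsub>\<lparr>carrier = X, eq = (=), le = (\<subseteq>)\<rparr>\<^esub> = s"
  unfolding bottom_def
  by (rule some_equality) (use assms in \<open>auto simp: least_def\<close>)

lemma sup_nabla_all_cong:
  assumes total: "kappa_congruence \<kappa> N (carrier N \<times> carrier N)"
    and bot: "\<bottom>\<^bsub>N\<^esub> \<in> carrier N" and A: "A \<subseteq> carrier N"
  shows "\<Squnion>\<^bsub>all_cong \<kappa> N\<^esub>(nabla \<kappa> N ` A) = cong_gen \<kappa> N {(\<bottom>\<^bsub>N\<^esub>, n) | n. n \<in> A}"
  unfolding all_cong_def
proof (rule sup_inclusion_eqI)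
  have sub: "{(\<bottom>\<^bsub>N\<^esub>, n) | n. n \<in> A} \<subseteq> carrier N \<times> carrier N"
    using bot A by auto
  note C = cong_gen_congruence[OF total sub]
  show "cong_gen \<kappa> N {(\<bottom>\<^bsub>N\<^esub>, n) | n. n \<in> A} \<in> {D. kappa_congruence \<kappa> N D}"
    using C by simp
  show "B \<subseteq> cong_gen \<kappa> N {(\<bottom>\<^bsub>N\<^esub>, n) | n. n \<in> A}" if "B \<in> nabla \<kappa> N ` A" for B
    using that
  proof
    fix n assume "B = nabla \<kappa> N n" "n \<in> A"
    then show ?thesis
      using cong_gen_incl[of "{(\<bottom>\<^bsub>N\<^esub>, n) | n. n \<in> A}" \<kappa> N]
      by (auto simp only: nabla_def intro!: cong_gen_least[OF C])
  qed
  show "nabla \<kappa> N ` A \<subseteq> {D. kappa_congruence \<kappa> N D}"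
    using A bot by (auto simp: nabla_def intro!: cong_gen_congruence[OF total])
  show "cong_gen \<kappa> N {(\<bottom>\<^bsub>N\<^esub>, n) | n. n \<in> A} \<subseteq> t"
    if "t \<in> {D. kappa_congruence \<kappa> N D}" "\<And>B. B \<in> nabla \<kappa> N ` A \<Longrightarrow> B \<subseteq> t" for t
  proof (rule cong_gen_least)
    have "(\<bottom>\<^bsub>N\<^esub>, n) \<in> nabla \<kappa> N n" for n
      using cong_gen_incl[of "{(\<bottom>\<^bsub>N\<^esub>, n)}" \<kappa> N] by (simp add: nabla_def)
    with that(2) show "{(\<bottom>\<^bsub>N\<^esub>, n) | n. n \<in> A} \<subseteq> t" by blast
  qed (use that in simp)
qed

text \<open>
  A generalised closed congruence is generated by pairs \<open>(\<bottom>, n)\<close>, and it lies in \<open>D\<close> iff these pairs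
  do. Hence the largest one is obtained from all pairs of this form in \<open>D\<close>.
\<close>

lemma gen_closure_eq_cong_gen:
  assumes total: "kappa_congruence \<kappa> N (carrier N \<times> carrier N)"
    and bot: "\<bottom>\<^bsub>N\<^esub> \<in> carrier N" and D: "kappa_congruence \<kappa> N D"
  shows "gen_closure \<kappa> N D = cong_gen \<kappa> N {(\<bottom>\<^bsub>N\<^esub>, n) | n. (\<bottom>\<^bsub>N\<^esub>, n) \<in> D}"
  unfolding gen_closure_def
proof (rule Greatest_equality)
  let ?A = "{n. (\<bottom>\<^bsub>N\<^esub>, n) \<in> D}"
  have A: "?A \<subseteq> carrier N"
    using kc_carrier[OF D] by blast
  show "gen_closed \<kappa> N (cong_gen \<kappa> N {(\<bottom>\<^bsub>N\<^esub>, n) | n. (\<bottom>\<^bsub>N\<^esub>, n) \<in> D}) \<and>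
      cong_gen \<kappa> N {(\<bottom>\<^bsub>N\<^esub>, n) | n. (\<bottom>\<^bsub>N\<^esub>, n) \<in> D} \<subseteq> D"
    unfolding gen_closed_def
  proof (intro conjI exI[of _ ?A])
    show "cong_gen \<kappa> N {(\<bottom>\<^bsub>N\<^esub>, n) | n. (\<bottom>\<^bsub>N\<^esub>, n) \<in> D} = \<Squnion>\<^bsub>all_cong \<kappa> N\<^esub>(nabla \<kappa> N ` ?A)"
      using sup_nabla_all_cong[OF total bot A] by simp
  qed (use A in \<open>auto intro!: cong_gen_least[OF D]\<close>)
next
  fix E assume E: "gen_closed \<kappa> N E \<and> E \<subseteq> D"
  then obtain A where A: "A \<subseteq> carrier N" and E_eq: "E = cong_gen \<kappa> N {(\<bottom>\<^bsub>N\<^esub>, n) | n. n \<in> A}"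
    using sup_nabla_all_cong[OF total bot] unfolding gen_closed_def by auto
  with E cong_gen_incl[of "{(\<bottom>\<^bsub>N\<^esub>, n) | n. n \<in> A}" \<kappa> N]
  have "{(\<bottom>\<^bsub>N\<^esub>, n) | n. n \<in> A} \<subseteq> {(\<bottom>\<^bsub>N\<^esub>, n) | n. (\<bottom>\<^bsub>N\<^esub>, n) \<in> D}"
    by blast
  then show "E \<le> cong_gen \<kappa> N {(\<bottom>\<^bsub>N\<^esub>, n) | n. (\<bottom>\<^bsub>N\<^esub>, n) \<in> D}"
    unfolding E_eq by (rule cong_gen_mono)
qed

lemma hom_kernel_congruence:
  assumes total: "kappa_congruence \<kappa> N (carrier N \<times> carrier N)"
    and hom: "kappa_hom \<kappa> N M \<phi>"
  shows "kappa_congruence \<kappa> N (hom_kernel N \<phi>)"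
proof (rule kappa_congruenceI)
  fix S assume S: "S \<subseteq> hom_kernel N \<phi>" "kappa_set \<kappa> S"
  then have sub: "S \<subseteq> carrier N \<times> carrier N" and eq: "\<And>p. p \<in> S \<Longrightarrow> \<phi> (fst p) = \<phi> (snd p)"
    by (auto simp: hom_kernel_def)
  from eq have "\<phi> ` fst ` S = \<phi> ` snd ` S"
    by (simp add: image_image)
  moreover have "fst ` S \<subseteq> carrier N" "snd ` S \<subseteq> carrier N"
    using sub by auto
  ultimately have "\<phi> (\<Squnion>\<^bsub>N\<^esub>(fst ` S)) = \<phi> (\<Squnion>\<^bsub>N\<^esub>(snd ` S))"
    using hom S(2) by (simp add: kappa_hom_def kappa_set_image)
  then show "(\<Squnion>\<^bsub>N\<^esub>(fst ` S), \<Squnion>\<^bsub>N\<^esub>(snd ` S)) \<in> hom_kernel N \<phi>"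
    using kc_sup[OF total sub S(2)] by (simp add: hom_kernel_def)
next
  fix x y x' y'
  assume "(x, y) \<in> hom_kernel N \<phi>" "(x', y') \<in> hom_kernel N \<phi>"
  then show "(x \<sqinter>\<^bsub>N\<^esub> x', y \<sqinter>\<^bsub>N\<^esub> y') \<in> hom_kernel N \<phi>"
    using kc_meet[OF total] hom by (auto simp: hom_kernel_def kappa_hom_def)
qed (auto simp: hom_kernel_def)


section \<open>Congruences on a kappa-frame\<close>

locale regular_kappa_frame = kappa_frame \<kappa> L
  for \<kappa> :: "'k kappa" and L :: "('a, 'c) gorder_scheme" (structure) +
  assumes ok: "kappa_ok \<kappa>"
begin

lemma kappa_sup_least:
  assumes "A \<subseteq> carrier L" "kappa_set \<kappa> A"
  shows "least L (\<Squnion>A) (Upper L A)"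
  using kappa_sup_exists[OF assms] unfolding sup_def by (rule someI_ex)

lemma kappa_sup_closed: "A \<subseteq> carrier L \<Longrightarrow> kappa_set \<kappa> A \<Longrightarrow> \<Squnion>A \<in> carrier L"
  using kappa_sup_least by (auto intro: least_closed)

lemma kappa_sup_upper: "A \<subseteq> carrier L \<Longrightarrow> kappa_set \<kappa> A \<Longrightarrow> x \<in> A \<Longrightarrow> x \<sqsubseteq> \<Squnion>A"
  using least_Upper_above[OF kappa_sup_least] by blast

lemma kappa_sup_le:
  assumes "A \<subseteq> carrier L" "kappa_set \<kappa> A" "u \<in> carrier L" "\<And>x. x \<in> A \<Longrightarrow> x \<sqsubseteq> u"
  shows "\<Squnion>A \<sqsubseteq> u"
  by (rule least_le[OF kappa_sup_least[OF assms(1,2)]]) (use assms in \<open>auto simp: Upper_def\<close>)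

text \<open>
  The element \<open>c\<close> is inserted so that the equation also covers \<open>A = {}\<close>, where the left side is \<open>c\<close>.
\<close>

lemma join_kappa_sup:
  assumes A: "A \<subseteq> carrier L" "kappa_set \<kappa> A" and c: "c \<in> carrier L"
  shows "\<Squnion>A \<squnion> c = \<Squnion>(insert c ((\<lambda>x. x \<squnion> c) ` A))"
proof (rule le_antisym)
  let ?B = "insert c ((\<lambda>x. x \<squnion> c) ` A)"
  have B: "?B \<subseteq> carrier L" "kappa_set \<kappa> ?B"
    using A c by (auto intro: kappa_set_insert[OF ok] kappa_set_image)
  note closed = kappa_sup_closed[OF A] kappa_sup_closed[OF B]
  then show "\<Squnion>A \<squnion> c \<in> carrier L" "\<Squnion>?B \<in> carrier L"
    using c by auto
  show "\<Squnion>A \<squnion> c \<sqsubseteq> \<Squnion>?B"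
  proof (intro join_le kappa_sup_le A closed c)
    show "c \<sqsubseteq> \<Squnion>?B" by (rule kappa_sup_upper[OF B]) simp
    fix x assume x: "x \<in> A"
    then have "x \<sqsubseteq> x \<squnion> c" using A c by (intro join_left) auto
    also have "x \<squnion> c \<sqsubseteq> \<Squnion>?B" by (rule kappa_sup_upper[OF B]) (use x in simp)
    finally show "x \<sqsubseteq> \<Squnion>?B" using x A c closed by auto
  qed
  show "\<Squnion>?B \<sqsubseteq> \<Squnion>A \<squnion> c"
  proof (intro kappa_sup_le B)
    fix x assume "x \<in> ?B"
    then consider "x = c" | y where "y \<in> A" "x = y \<squnion> c" by blast
    then show "x \<sqsubseteq> \<Squnion>A \<squnion> c"
    proof cases
      case 1 then show ?thesis using c closed by (simp add: join_right)
    next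
      case 2
      then have y: "y \<in> carrier L" using A by auto
      have "y \<sqsubseteq> \<Squnion>A \<squnion> c"
        using le_trans[OF kappa_sup_upper[OF A 2(1)] join_left] y c closed by auto
      then show ?thesis unfolding 2 using y c closed by (intro join_le) (auto simp: join_right)
    qed
  qed (use c closed in auto)
qed

lemma absorb_le:
  assumes "x \<in> carrier L" "y \<in> carrier L" "x \<sqsubseteq> y"
  shows "x \<squnion> y = y" "y \<squnion> x = y" "x \<sqinter> y = x" "y \<sqinter> x = x"
  using assms le_iff_join[of x y] le_iff_meet[of x y] by (metis join_comm meet_comm)+

lemma join_meet_distrib:
  assumes [simp]: "x \<in> carrier L" "y \<in> carrier L" "c \<in> carrier L"
  shows "(x \<sqinter> y) \<squnion> c = (x \<squnion> c) \<sqinter> (y \<squnion> c)"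
proof (rule le_antisym)
  show "(x \<sqinter> y) \<squnion> c \<sqsubseteq> (x \<squnion> c) \<sqinter> (y \<squnion> c)"
  proof (intro meet_le join_le)
    show "x \<sqinter> y \<sqsubseteq> x \<squnion> c" "x \<sqinter> y \<sqsubseteq> y \<squnion> c"
      using le_trans[OF meet_left join_left] le_trans[OF meet_right join_left] by auto
  qed (auto simp: join_right)
  have "(x \<squnion> c) \<sqinter> (y \<squnion> c) = ((x \<squnion> c) \<sqinter> y) \<squnion> ((x \<squnion> c) \<sqinter> c)"
    by (rule distrib) auto
  also have "(x \<squnion> c) \<sqinter> y = (y \<sqinter> x) \<squnion> (y \<sqinter> c)"
    by (simp add: meet_comm[of L "x \<squnion> c"] distrib)
  also have "((y \<sqinter> x) \<squnion> (y \<sqinter> c)) \<squnion> ((x \<squnion> c) \<sqinter> c) \<sqsubseteq> (x \<sqinter> y) \<squnion> c"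
  proof (intro join_le)
    show "y \<sqinter> x \<sqsubseteq> (x \<sqinter> y) \<squnion> c" by (subst meet_comm) (simp add: join_left)
    show "y \<sqinter> c \<sqsubseteq> (x \<sqinter> y) \<squnion> c" "(x \<squnion> c) \<sqinter> c \<sqsubseteq> (x \<sqinter> y) \<squnion> c"
      using le_trans[OF meet_right join_right] by auto
  qed auto
  finally show "(x \<squnion> c) \<sqinter> (y \<squnion> c) \<sqsubseteq> (x \<sqinter> y) \<squnion> c" .
qed auto

lemma eq_if_join_meet_eq:
  assumes [simp]: "x \<in> carrier L" "y \<in> carrier L" "a \<in> carrier L"
    and j: "x \<squnion> a = y \<squnion> a" and m: "x \<sqinter> a = y \<sqinter> a"
  shows "x = y"
proof -
  have "x = x \<sqinter> (x \<squnion> a)" by (simp add: absorb_le join_left)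
  also have "\<dots> = (x \<sqinter> y) \<squnion> (x \<sqinter> a)" by (simp add: j distrib)
  also have "\<dots> = (y \<sqinter> x) \<squnion> (y \<sqinter> a)" by (simp add: m meet_comm[of L x y])
  also have "\<dots> = y \<sqinter> (y \<squnion> a)" by (simp add: j[symmetric] distrib)
  also have "\<dots> = y" by (simp add: absorb_le join_left)
  finally show ?thesis .
qed

lemma total_congruence: "kappa_congruence \<kappa> L (carrier L \<times> carrier L)"
proof (rule kappa_congruenceI)
  fix S assume "S \<subseteq> carrier L \<times> carrier L" "kappa_set \<kappa> S"
  then show "(\<Squnion>(fst ` S), \<Squnion>(snd ` S)) \<in> carrier L \<times> carrier L"
    by (auto intro!: kappa_sup_closed kappa_set_image)
qed auto

lemmas cong_gen_cong = cong_gen_congruence[OF total_congruence]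

lemma Id_congruence: "kappa_congruence \<kappa> L (Id_on (carrier L))"
proof (rule kappa_congruenceI)
  fix S assume S: "S \<subseteq> Id_on (carrier L)" "kappa_set \<kappa> S"
  have "fst ` S = snd ` S"
    by (rule image_cong) (use S(1) in auto)
  moreover have "\<Squnion>(fst ` S) \<in> carrier L"
    by (rule kappa_sup_closed) (use S in \<open>auto intro: kappa_set_image\<close>)
  ultimately show "(\<Squnion>(fst ` S), \<Squnion>(snd ` S)) \<in> Id_on (carrier L)"
    by (simp add: Id_on_iff)
qed auto

text \<open>
  The maps \<open>x \<mapsto> x \<squnion> c\<close> and \<open>x \<mapsto> x \<sqinter> c\<close> are in general not frame homomorphisms: the first moves \<open>\<bottom>\<close> and the
  second moves \<open>\<top>\<close>. They preserve binary meets and nonempty joins, and that is enough for the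
  preimage of a congruence to be a congruence. Such preimages are used to bound generated
  congruences from above.
\<close>

lemma join_pullback:
  assumes D: "kappa_congruence \<kappa> L D" and c: "c \<in> carrier L"
  shows "kappa_congruence \<kappa> L
    {(x, y). x \<in> carrier L \<and> y \<in> carrier L \<and> (x \<squnion> c, y \<squnion> c) \<in> D}"
    (is "kappa_congruence \<kappa> L ?E")
proof (rule kappa_congruenceI)
  fix x y x' y' assume "(x, y) \<in> ?E" "(x', y') \<in> ?E"
  then show "(x \<sqinter> x', y \<sqinter> y') \<in> ?E"
    using kc_meet[OF D, of "x \<squnion> c" "y \<squnion> c" "x' \<squnion> c" "y' \<squnion> c"] c by (simp add: join_meet_distrib)
next
  fix S assume S: "S \<subseteq> ?E" "kappa_set \<kappa> S"
  let ?T = "insert (c, c) ((\<lambda>(x, y). (x \<squnion> c, y \<squnion> c)) ` S)"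
  have "?T \<subseteq> D" "kappa_set \<kappa> ?T"
    using S c kc_refl[OF D] by (auto intro!: kappa_set_insert[OF ok] kappa_set_image)
  from kc_sup[OF D this]
  have "(\<Squnion>(insert c ((\<lambda>x. x \<squnion> c) ` fst ` S)), \<Squnion>(insert c ((\<lambda>x. x \<squnion> c) ` snd ` S))) \<in> D"
    by (simp add: image_image case_prod_beta)
  moreover have F: "fst ` S \<subseteq> carrier L" "snd ` S \<subseteq> carrier L"
    "kappa_set \<kappa> (fst ` S)" "kappa_set \<kappa> (snd ` S)"
    using S by (auto intro: kappa_set_image)
  ultimately show "(\<Squnion>(fst ` S), \<Squnion>(snd ` S)) \<in> ?E"
    using c by (simp add: join_kappa_sup kappa_sup_closed)
qed (use D c in \<open>auto intro: kc_refl kc_sym kc_trans\<close>)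

lemma meet_pullback:
  assumes D: "kappa_congruence \<kappa> L D" and c: "c \<in> carrier L"
  shows "kappa_congruence \<kappa> L
    {(x, y). x \<in> carrier L \<and> y \<in> carrier L \<and> (x \<sqinter> c, y \<sqinter> c) \<in> D}"
    (is "kappa_congruence \<kappa> L ?E")
proof (rule kappa_congruenceI)
  have eq: "(x \<sqinter> c) \<sqinter> (x' \<sqinter> c) = (x \<sqinter> x') \<sqinter> c" if "x \<in> carrier L" "x' \<in> carrier L" for x x'
  proof (rule le_antisym)
    show "(x \<sqinter> c) \<sqinter> (x' \<sqinter> c) \<sqsubseteq> (x \<sqinter> x') \<sqinter> c"
      using that c le_trans[OF meet_left meet_left, of "x \<sqinter> c" "x' \<sqinter> c"]
        le_trans[OF meet_left meet_left, of x c "x' \<sqinter> c"]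
        le_trans[OF meet_right meet_left, of "x \<sqinter> c" x' c]
        le_trans[OF meet_right meet_right, of "x \<sqinter> c" x' c]
      by (intro meet_le) auto
    show "(x \<sqinter> x') \<sqinter> c \<sqsubseteq> (x \<sqinter> c) \<sqinter> (x' \<sqinter> c)"
      using that c le_trans[OF meet_left meet_left, of x x' c]
        le_trans[OF meet_left meet_right, of x x' c]
      by (intro meet_le) (auto simp: meet_right)
  qed (use that c in auto)
  fix x y x' y' assume "(x, y) \<in> ?E" "(x', y') \<in> ?E"
  then show "(x \<sqinter> x', y \<sqinter> y') \<in> ?E"
    using kc_meet[OF D, of "x \<sqinter> c" "y \<sqinter> c" "x' \<sqinter> c" "y' \<sqinter> c"] by (simp add: eq)
next
  fix S assume S: "S \<subseteq> ?E" "kappa_set \<kappa> S"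
  let ?T = "(\<lambda>(x, y). (x \<sqinter> c, y \<sqinter> c)) ` S"
  have "?T \<subseteq> D" "kappa_set \<kappa> ?T"
    using S by (auto intro!: kappa_set_image)
  from kc_sup[OF D this]
  have "(\<Squnion>((\<lambda>x. c \<sqinter> x) ` fst ` S), \<Squnion>((\<lambda>x. c \<sqinter> x) ` snd ` S)) \<in> D"
    unfolding meet_comm[of L c] by (simp add: image_image case_prod_beta)
  moreover have F: "fst ` S \<subseteq> carrier L" "snd ` S \<subseteq> carrier L"
    "kappa_set \<kappa> (fst ` S)" "kappa_set \<kappa> (snd ` S)"
    using S by (auto intro: kappa_set_image)
  ultimately have "(c \<sqinter> \<Squnion>(fst ` S), c \<sqinter> \<Squnion>(snd ` S)) \<in> D"
    using c by (simp add: kappa_distrib)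
  then show "(\<Squnion>(fst ` S), \<Squnion>(snd ` S)) \<in> ?E"
    using F by (simp add: kappa_sup_closed meet_comm[of L c])
qed (use D c in \<open>auto intro: kc_refl kc_sym kc_trans\<close>)

lemma kc_meet_right:
  "kappa_congruence \<kappa> L D \<Longrightarrow> (x, y) \<in> D \<Longrightarrow> c \<in> carrier L \<Longrightarrow> (x \<sqinter> c, y \<sqinter> c) \<in> D"
  by (intro kc_meet kc_refl)

lemma kc_join_right:
  "kappa_congruence \<kappa> L D \<Longrightarrow> (x, y) \<in> D \<Longrightarrow> c \<in> carrier L \<Longrightarrow> (x \<squnion> c, y \<squnion> c) \<in> D"
  by (rule kc_join[OF ok]) (auto intro: kc_refl)

text \<open>
  This reduces questions about arbitrary pairs to comparable ones.
\<close>

lemma kc_meet_join_iff: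
  assumes D: "kappa_congruence \<kappa> L D" and [simp]: "x \<in> carrier L" "y \<in> carrier L"
  shows "(x \<sqinter> y, x \<squnion> y) \<in> D \<longleftrightarrow> (x, y) \<in> D"
proof
  assume xy: "(x, y) \<in> D"
  have "(x \<sqinter> y, y) \<in> D" "(x \<squnion> y, y) \<in> D"
    using kc_meet_right[OF D xy, of y] kc_join_right[OF D xy, of y] by (simp_all add: absorb_le)
  then show "(x \<sqinter> y, x \<squnion> y) \<in> D"
    by (rule kc_trans[OF D _ kc_sym[OF D]])
next
  assume m: "(x \<sqinter> y, x \<squnion> y) \<in> D"
  have "(x \<sqinter> y, z) \<in> D" if z: "z \<in> {x, y}" for z
  proof -
    have "x \<sqinter> y \<sqsubseteq> z" "z \<sqsubseteq> x \<squnion> y" "z \<in> carrier L"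
      using z by (auto simp: meet_left meet_right join_left join_right)
    then show ?thesis
      using kc_meet_right[OF D m, of z] by (simp add: absorb_le)
  qed
  from kc_trans[OF D kc_sym[OF D this[of x]] this[of y]]
  show "(x, y) \<in> D" by simp
qed

lemma cong_gen_ordered_pairs:
  assumes "S \<subseteq> carrier L \<times> carrier L"
  shows "cong_gen \<kappa> L ((\<lambda>(x, y). (x \<sqinter> y, x \<squnion> y)) ` S) = cong_gen \<kappa> L S"
proof -
  have "(\<lambda>(x, y). (x \<sqinter> y, x \<squnion> y)) ` S \<subseteq> D \<longleftrightarrow> S \<subseteq> D" if D: "kappa_congruence \<kappa> L D" for D
  proof -
    have "(\<lambda>(x, y). (x \<sqinter> y, x \<squnion> y)) p \<in> D \<longleftrightarrow> p \<in> D" if "p \<in> S" for p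
      using that assms kc_meet_join_iff[OF D, of "fst p" "snd p"] by (cases p) auto
    then show ?thesis
      unfolding image_subset_iff unfolding subset_eq by (rule ball_cong[OF HOL.refl])
  qed
  then show ?thesis
    unfolding cong_gen_def by (intro arg_cong[where f = Inter] Collect_cong conj_cong HOL.refl)
qed

text \<open>
  The generators on the right belong to both congruences: from \<open>(a, b)\<close> by joining \<open>c\<close> and meeting
  \<open>d\<close>, and from \<open>(c, d)\<close> because both components are then congruent to \<open>d\<close>. The other inclusion lets
  the pairs of \<open>S\<close> and \<open>T\<close> spread out one set at a time. For fixed \<open>(c, d)\<close> the pairs \<open>(x, y)\<close> with
  \<open>((x \<squnion> c) \<sqinter> d, (y \<squnion> c) \<sqinter> d)\<close> in the right-hand side form a congruence containing \<open>S\<close>; for a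
  fixed pair \<open>x \<le> y\<close> in the congruence generated by \<open>S\<close>, the pairs \<open>(c, d)\<close> with
  \<open>((c \<squnion> x) \<sqinter> y, (d \<squnion> x) \<sqinter> y)\<close> in it form a congruence containing \<open>T\<close>. Taking \<open>(c, d) = (x, y)\<close>
  there gives \<open>(x, y)\<close> itself.
\<close>

lemma cong_gen_Int:
  assumes S: "S \<subseteq> carrier L \<times> carrier L" and T: "T \<subseteq> carrier L \<times> carrier L"
    and T_le: "\<And>c d. (c, d) \<in> T \<Longrightarrow> c \<sqsubseteq> d"
  shows "cong_gen \<kappa> L S \<inter> cong_gen \<kappa> L T =
    cong_gen \<kappa> L ((\<lambda>((a, b), (c, d)). ((a \<squnion> c) \<sqinter> d, (b \<squnion> c) \<sqinter> d)) ` (S \<times> T))"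
    (is "_ = cong_gen \<kappa> L ?G")
proof (intro subset_antisym subrelI)
  have G: "?G \<subseteq> carrier L \<times> carrier L"
  proof
    fix p assume "p \<in> ?G"
    then obtain a b c d where p: "(a, b) \<in> S" "(c, d) \<in> T"
      "p = ((a \<squnion> c) \<sqinter> d, (b \<squnion> c) \<sqinter> d)" by auto
    then have "a \<in> carrier L" "b \<in> carrier L" "c \<in> carrier L" "d \<in> carrier L"
      using S T by auto
    then show "p \<in> carrier L \<times> carrier L" using p(3) by simp
  qed
  note CS = cong_gen_cong[OF S] and CT = cong_gen_cong[OF T] and CG = cong_gen_cong[OF G]
  show "(x, y) \<in> cong_gen \<kappa> L S \<inter> cong_gen \<kappa> L T" if "(x, y) \<in> cong_gen \<kappa> L ?G" for x y
  proof -
    have "?G \<subseteq> cong_gen \<kappa> L S"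
    proof clarify
      fix a b c d assume ab: "(a, b) \<in> S" and cd: "(c, d) \<in> T"
      have "c \<in> carrier L" "d \<in> carrier L"
        using cd T by auto
      then show "((a \<squnion> c) \<sqinter> d, (b \<squnion> c) \<sqinter> d) \<in> cong_gen \<kappa> L S"
        using ab cong_gen_incl[of S \<kappa> L] by (intro kc_meet_right[OF CS] kc_join_right[OF CS]) auto
    qed
    moreover have "?G \<subseteq> cong_gen \<kappa> L T"
    proof clarify
      fix a b c d assume ab: "(a, b) \<in> S" and cd: "(c, d) \<in> T"
      then have carr: "a \<in> carrier L" "b \<in> carrier L" "c \<in> carrier L" "d \<in> carrier L"
        using S T by auto
      have "((u \<squnion> c) \<sqinter> d, d) \<in> cong_gen \<kappa> L T" if u: "u \<in> carrier L" for u
      proof -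
        have "(c, d) \<in> cong_gen \<kappa> L T"
          using cd cong_gen_incl[of T \<kappa> L] by blast
        then have "((c \<squnion> u) \<sqinter> d, (d \<squnion> u) \<sqinter> d) \<in> cong_gen \<kappa> L T"
          by (intro kc_meet_right[OF CT] kc_join_right[OF CT] carr u)
        moreover have "(d \<squnion> u) \<sqinter> d = d"
          using carr u by (intro absorb_le(4)) (auto simp: join_left)
        ultimately show ?thesis by (simp add: join_comm[of L u])
      qed
      then show "((a \<squnion> c) \<sqinter> d, (b \<squnion> c) \<sqinter> d) \<in> cong_gen \<kappa> L T"
        using carr by (blast intro: kc_trans[OF CT _ kc_sym[OF CT]])
    qed
    ultimately show ?thesis
      using that cong_gen_least[OF CS] cong_gen_least[OF CT] by blast
  qed
  have S_step: "((x \<squnion> c) \<sqinter> d, (y \<squnion> c) \<sqinter> d) \<in> cong_gen \<kappa> L ?G"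
    if xy: "(x, y) \<in> cong_gen \<kappa> L S" and cd: "(c, d) \<in> T" for x y c d
  proof -
    have carr: "c \<in> carrier L" "d \<in> carrier L"
      using cd T by auto
    have "S \<subseteq> {(x, y). x \<in> carrier L \<and> y \<in> carrier L \<and> (x \<squnion> c, y \<squnion> c) \<in>
      {(x, y). x \<in> carrier L \<and> y \<in> carrier L \<and> (x \<sqinter> d, y \<sqinter> d) \<in> cong_gen \<kappa> L ?G}}"
    proof (intro subrelI)
      fix a b assume ab: "(a, b) \<in> S"
      then have "a \<in> carrier L" "b \<in> carrier L"
        using S by auto
      moreover have "((a \<squnion> c) \<sqinter> d, (b \<squnion> c) \<sqinter> d) \<in> ?G"
        by (rule image_eqI[where x = "((a, b), (c, d))"]) (use ab cd in simp_all)
      ultimately show "(a, b) \<in> {(x, y). x \<in> carrier L \<and> y \<in> carrier L \<and> (x \<squnion> c, y \<squnion> c) \<in>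
        {(x, y). x \<in> carrier L \<and> y \<in> carrier L \<and> (x \<sqinter> d, y \<sqinter> d) \<in> cong_gen \<kappa> L ?G}}"
        using carr set_mp[OF cong_gen_incl[of ?G \<kappa> L]] by simp
    qed
    from set_mp[OF cong_gen_least[OF join_pullback[OF meet_pullback[OF CG carr(2)] carr(1)] this] xy]
    show ?thesis by simp
  qed
  have ordered: "(x, y) \<in> cong_gen \<kappa> L ?G"
    if xyS: "(x, y) \<in> cong_gen \<kappa> L S" and xyT: "(x, y) \<in> cong_gen \<kappa> L T" and le: "x \<sqsubseteq> y" for x y
  proof -
    have carr: "x \<in> carrier L" "y \<in> carrier L"
      using kc_carrier[OF CS xyS] by auto
    have "((c \<squnion> x) \<sqinter> y, (d \<squnion> x) \<sqinter> y) \<in> cong_gen \<kappa> L ?G" if cd: "(c, d) \<in> T" for c d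
    proof -
      have cd': "c \<in> carrier L" "d \<in> carrier L" "c \<sqsubseteq> d"
        using cd T T_le by auto
      \<comment> \<open>Cutting the pair down to the interval from \<open>x\<close> to \<open>y\<close> exchanges the roles of \<open>(x, y)\<close> and \<open>(c, d)\<close>.\<close>
      have "(((x \<squnion> c) \<sqinter> d) \<sqinter> y \<squnion> x, ((y \<squnion> c) \<sqinter> d) \<sqinter> y \<squnion> x) \<in> cong_gen \<kappa> L ?G"
        by (intro kc_join_right[OF CG] kc_meet_right[OF CG] S_step xyS cd carr)
      moreover have "((x \<squnion> c) \<sqinter> d) \<sqinter> y \<squnion> x = (c \<squnion> x) \<sqinter> y"
      proof -
        have "c \<squnion> x \<sqsubseteq> d \<squnion> x"
          using carr cd' le_trans[OF cd'(3) join_left[of d x]] by (intro join_le) (auto simp: join_right)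
        moreover have "x \<squnion> c = c \<squnion> x" by (rule join_comm)
        moreover have "x \<sqsubseteq> c \<squnion> x" using carr cd' by (simp add: join_right)
        ultimately show ?thesis
          using carr cd' le by (simp add: join_meet_distrib absorb_le)
      qed
      moreover have "((y \<squnion> c) \<sqinter> d) \<sqinter> y \<squnion> x = (d \<squnion> x) \<sqinter> y"
      proof -
        have "y \<squnion> c \<squnion> x = y \<squnion> c"
          using carr cd' le_trans[OF le join_left[of y c]] by (intro absorb_le) auto
        moreover have "((y \<squnion> c) \<sqinter> (d \<squnion> x)) \<sqinter> y = (d \<squnion> x) \<sqinter> y"
        proof (rule le_antisym)
          show "(y \<squnion> c) \<sqinter> (d \<squnion> x) \<sqinter> y \<sqsubseteq> (d \<squnion> x) \<sqinter> y"
            using carr cd' le_trans[OF meet_left meet_right, of "y \<squnion> c" "d \<squnion> x" y]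
            by (intro meet_le) (auto simp: meet_right)
          show "(d \<squnion> x) \<sqinter> y \<sqsubseteq> (y \<squnion> c) \<sqinter> (d \<squnion> x) \<sqinter> y"
            using carr cd' le_trans[OF meet_right join_left, of "d \<squnion> x" y c]
            by (intro meet_le) (auto simp: meet_right meet_left)
        qed (use carr cd' in auto)
        ultimately show ?thesis
          using carr cd' le by (simp add: join_meet_distrib absorb_le)
      qed
      ultimately show ?thesis by simp
    qed
    then have "T \<subseteq> {(c, d). c \<in> carrier L \<and> d \<in> carrier L \<and> (c \<squnion> x, d \<squnion> x) \<in>
      {(c, d). c \<in> carrier L \<and> d \<in> carrier L \<and> (c \<sqinter> y, d \<sqinter> y) \<in> cong_gen \<kappa> L ?G}}"
      using T carr by auto
    from set_mp[OF cong_gen_least[OF join_pullback[OF meet_pullback[OF CG carr(2)] carr(1)] this] xyT]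
    show ?thesis using carr le by (simp add: absorb_le)
  qed
  show "(x, y) \<in> cong_gen \<kappa> L ?G" if "(x, y) \<in> cong_gen \<kappa> L S \<inter> cong_gen \<kappa> L T" for x y
  proof -
    have carr: "x \<in> carrier L" "y \<in> carrier L"
      using that kc_carrier[OF CS, of x y] by auto
    have "x \<sqinter> y \<sqsubseteq> x \<squnion> y"
      using carr le_trans[OF meet_left join_left, of x y y] by auto
    then have "(x \<sqinter> y, x \<squnion> y) \<in> cong_gen \<kappa> L ?G"
      using that carr kc_meet_join_iff[OF CS carr] kc_meet_join_iff[OF CT carr]
      by (intro ordered) auto
    then show ?thesis using kc_meet_join_iff[OF CG carr] by simp
  qed
qed

text \<open>
  Pairs in \<open>\<nabla>\<^sub>a\<close> agree after joining with \<open>a\<close>, and pairs in the congruence generated by \<open>(a, b)\<close>, where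
  \<open>a \<le> b\<close>, agree after meeting with \<open>a\<close>. In a distributive lattice both together force equality.
\<close>

lemma nabla_Int_principal:
  assumes a: "a \<in> carrier L" and b: "b \<in> carrier L" and le: "a \<sqsubseteq> b"
  shows "nabla \<kappa> L a \<inter> cong_gen \<kappa> L {(a, b)} = Id_on (carrier L)"
proof (intro subset_antisym Int_greatest)
  have "{(\<bottom>, a)} \<subseteq> {(x, y). x \<in> carrier L \<and> y \<in> carrier L \<and> (x \<squnion> a, y \<squnion> a) \<in> Id_on (carrier L)}"
    using a by (simp add: Id_on_iff absorb_le)
  then have n: "nabla \<kappa> L a \<subseteq> {(x, y). x \<in> carrier L \<and> y \<in> carrier L \<and> (x \<squnion> a, y \<squnion> a) \<in> Id_on (carrier L)}"
    unfolding nabla_def by (rule cong_gen_least[OF join_pullback[OF Id_congruence a]])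
  have "{(a, b)} \<subseteq> {(x, y). x \<in> carrier L \<and> y \<in> carrier L \<and> (x \<sqinter> a, y \<sqinter> a) \<in> Id_on (carrier L)}"
    using a b le by (simp add: Id_on_iff absorb_le)
  then have p: "cong_gen \<kappa> L {(a, b)} \<subseteq> {(x, y). x \<in> carrier L \<and> y \<in> carrier L \<and> (x \<sqinter> a, y \<sqinter> a) \<in> Id_on (carrier L)}"
    by (rule cong_gen_least[OF meet_pullback[OF Id_congruence a]])
  show "nabla \<kappa> L a \<inter> cong_gen \<kappa> L {(a, b)} \<subseteq> Id_on (carrier L)"
  proof (intro subrelI)
    fix x y assume xy: "(x, y) \<in> nabla \<kappa> L a \<inter> cong_gen \<kappa> L {(a, b)}"
    have "x \<in> carrier L \<and> y \<in> carrier L \<and> x \<squnion> a = y \<squnion> a"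
      using set_mp[OF n, of "(x, y)"] xy by (simp add: Id_on_iff)
    moreover have "x \<sqinter> a = y \<sqinter> a"
      using set_mp[OF p, of "(x, y)"] xy by (simp add: Id_on_iff)
    ultimately show "(x, y) \<in> Id_on (carrier L)"
      using eq_if_join_meet_eq[of x y a] a by (simp add: Id_on_iff)
  qed
  have "Id_on (carrier L) \<subseteq> cong_gen \<kappa> L S" if "S \<subseteq> carrier L \<times> carrier L" for S
    using kc_refl[OF cong_gen_cong[OF that]] by auto
  then show "Id_on (carrier L) \<subseteq> nabla \<kappa> L a" "Id_on (carrier L) \<subseteq> cong_gen \<kappa> L {(a, b)}"
    using a b by (simp_all add: nabla_def)
qed

lemma nabla_eq_gen_Un:
  assumes a: "a \<in> carrier L" and b: "b \<in> carrier L" and le: "a \<sqsubseteq> b"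
  shows "nabla \<kappa> L b = cong_gen \<kappa> L (nabla \<kappa> L a \<union> cong_gen \<kappa> L {(a, b)})"
proof (rule subset_antisym)
  have na: "kappa_congruence \<kappa> L (nabla \<kappa> L a)" and nb: "kappa_congruence \<kappa> L (nabla \<kappa> L b)"
    and p: "kappa_congruence \<kappa> L (cong_gen \<kappa> L {(a, b)})"
    unfolding nabla_def using a b by (auto intro!: cong_gen_cong)
  have "nabla \<kappa> L a \<union> cong_gen \<kappa> L {(a, b)} \<subseteq> carrier L \<times> carrier L"
    using kc_carrier[OF na] kc_carrier[OF p] by auto
  note u = cong_gen_cong[OF this]
  have "(\<bottom>, a) \<in> nabla \<kappa> L a" "(a, b) \<in> cong_gen \<kappa> L {(a, b)}"
    using cong_gen_incl[of "{(\<bottom>, a)}" \<kappa> L] cong_gen_incl[of "{(a, b)}" \<kappa> L] by (simp_all add: nabla_def)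
  then have "(\<bottom>, b) \<in> cong_gen \<kappa> L (nabla \<kappa> L a \<union> cong_gen \<kappa> L {(a, b)})"
    using set_mp[OF cong_gen_incl[of "nabla \<kappa> L a \<union> cong_gen \<kappa> L {(a, b)}" \<kappa> L]]
    by (intro kc_trans[OF u, of "\<bottom>" a b]) auto
  then show "nabla \<kappa> L b \<subseteq> cong_gen \<kappa> L (nabla \<kappa> L a \<union> cong_gen \<kappa> L {(a, b)})"
    unfolding nabla_def[of \<kappa> L b] by (intro cong_gen_least[OF u]) simp
  have b0: "(\<bottom>, b) \<in> nabla \<kappa> L b"
    using cong_gen_incl[of "{(\<bottom>, b)}" \<kappa> L] by (simp add: nabla_def)
  have a0: "(\<bottom>, a) \<in> nabla \<kappa> L b"
    using kc_meet_right[OF nb b0 a] a b le by (simp add: absorb_le)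
  have "(a, b) \<in> nabla \<kappa> L b"
    by (rule kc_trans[OF nb kc_sym[OF nb a0] b0])
  then show "cong_gen \<kappa> L (nabla \<kappa> L a \<union> cong_gen \<kappa> L {(a, b)}) \<subseteq> nabla \<kappa> L b"
    using a0 unfolding nabla_def[of \<kappa> L a] by (intro cong_gen_least[OF nb] Un_least) auto
qed


section \<open>The frame of congruences\<close>

abbreviation CL :: "'a rel gorder" where "CL \<equiv> cong_frame \<kappa> L"

lemma CL_carrierI:
  "S \<subseteq> carrier L \<times> carrier L \<Longrightarrow> kappa_set \<kappa> S \<Longrightarrow> cong_gen \<kappa> L S \<in> carrier CL"
  by (auto simp: cong_frame_def)

lemma CL_carrierE:
  assumes "A \<in> carrier CL"
  obtains S where "S \<subseteq> carrier L \<times> carrier L" "kappa_set \<kappa> S" "A = cong_gen \<kappa> L S"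
  using assms by (auto simp: cong_frame_def)

lemma CL_ordered_generators:
  assumes "A \<in> carrier CL"
  obtains S where "S \<subseteq> carrier L \<times> carrier L" "kappa_set \<kappa> S" "A = cong_gen \<kappa> L S"
    "\<And>a b. (a, b) \<in> S \<Longrightarrow> a \<sqsubseteq> b"
proof -
  obtain S where S: "S \<subseteq> carrier L \<times> carrier L" "kappa_set \<kappa> S" "A = cong_gen \<kappa> L S"
    using assms by (rule CL_carrierE)
  let ?T = "(\<lambda>(x, y). (x \<sqinter> y, x \<squnion> y)) ` S"
  have T: "p \<in> carrier L \<times> carrier L \<and> fst p \<sqsubseteq> snd p" if "p \<in> ?T" for p
  proof -
    obtain q where "q \<in> S" "p = (\<lambda>(x, y). (x \<sqinter> y, x \<squnion> y)) q"
      using \<open>p \<in> ?T\<close> by (rule imageE)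
    then obtain x y where "(x, y) \<in> S" "p = (x \<sqinter> y, x \<squnion> y)"
      by (cases q) simp
    moreover from this have "x \<in> carrier L" "y \<in> carrier L" using S(1) by auto
    moreover from this have "x \<sqinter> y \<sqsubseteq> x \<squnion> y"
      using le_trans[OF meet_left join_left, of x y y] by simp
    ultimately show ?thesis by simp
  qed
  show thesis
  proof (rule that)
    show "?T \<subseteq> carrier L \<times> carrier L" using T by blast
    show "kappa_set \<kappa> ?T" using S(2) by (rule kappa_set_image)
    show "A = cong_gen \<kappa> L ?T" using S by (simp add: cong_gen_ordered_pairs)
    show "a \<sqsubseteq> b" if "(a, b) \<in> ?T" for a b using T[OF that] by simp
  qed
qed

lemma CL_congruence: "A \<in> carrier CL \<Longrightarrow> kappa_congruence \<kappa> L A"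
  by (elim CL_carrierE) (simp add: cong_gen_cong)

text \<open>
  Regularity of \<open>\<kappa>\<close> enters here: a union of fewer than \<open>\<kappa>\<close> generating sets is again a \<open>\<kappa>\<close>-set.
\<close>

lemma CL_sup:
  assumes F: "F \<subseteq> carrier CL" "kappa_set \<kappa> F"
  shows CL_sup_closed: "cong_gen \<kappa> L (\<Union>F) \<in> carrier CL"
    and CL_sup_eq: "\<Squnion>\<^bsub>CL\<^esub>F = cong_gen \<kappa> L (\<Union>F)"
proof -
  have "\<forall>A\<in>F. \<exists>S. S \<subseteq> carrier L \<times> carrier L \<and> kappa_set \<kappa> S \<and> A = cong_gen \<kappa> L S"
    using F(1) by (auto elim: CL_carrierE)
  then obtain g where g: "\<And>A. A \<in> F \<Longrightarrow> g A \<subseteq> carrier L \<times> carrier L"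
    "\<And>A. A \<in> F \<Longrightarrow> kappa_set \<kappa> (g A)" "\<And>A. A \<in> F \<Longrightarrow> A = cong_gen \<kappa> L (g A)"
    by metis
  have "\<Union>F \<subseteq> D \<longleftrightarrow> (\<Union>A\<in>F. g A) \<subseteq> D" if D: "kappa_congruence \<kappa> L D" for D
  proof -
    have "A \<subseteq> D \<longleftrightarrow> g A \<subseteq> D" if "A \<in> F" for A
      using g(3)[OF that] cong_gen_incl[of "g A" \<kappa> L] cong_gen_least[OF D, of "g A"] by auto
    then show ?thesis by (simp add: Sup_le_iff UN_subset_iff)
  qed
  then have eq: "cong_gen \<kappa> L (\<Union>F) = cong_gen \<kappa> L (\<Union>A\<in>F. g A)"
    unfolding cong_gen_def by (intro arg_cong[where f = Inter] Collect_cong conj_cong HOL.refl)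
  show closed: "cong_gen \<kappa> L (\<Union>F) \<in> carrier CL"
    unfolding eq using g(1,2) F(2) by (intro CL_carrierI kappa_set_UN[OF ok]) auto
  have "cong_gen \<kappa> L (\<Union>F) \<subseteq> t" if "t \<in> carrier CL" "\<And>A. A \<in> F \<Longrightarrow> A \<subseteq> t" for t
    using that by (intro cong_gen_least CL_congruence) auto
  moreover have "A \<subseteq> cong_gen \<kappa> L (\<Union>F)" if "A \<in> F" for A
    using that cong_gen_incl[of "\<Union>F" \<kappa> L] by auto
  ultimately show "\<Squnion>\<^bsub>CL\<^esub>F = cong_gen \<kappa> L (\<Union>F)"
    using closed F(1) unfolding cong_frame_def by (intro sup_inclusion_eqI) auto
qed

lemma CL_meet:
  assumes "A \<in> carrier CL" "B \<in> carrier CL"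
  shows CL_Int_closed: "A \<inter> B \<in> carrier CL"
    and CL_meet_eq: "A \<sqinter>\<^bsub>CL\<^esub> B = A \<inter> B"
proof -
  obtain S where S: "S \<subseteq> carrier L \<times> carrier L" "kappa_set \<kappa> S" "A = cong_gen \<kappa> L S"
    using assms(1) by (rule CL_carrierE)
  obtain T where T: "T \<subseteq> carrier L \<times> carrier L" "kappa_set \<kappa> T" "B = cong_gen \<kappa> L T"
    and T_le: "\<And>c d. (c, d) \<in> T \<Longrightarrow> c \<sqsubseteq> d"
    using assms(2) by (rule CL_ordered_generators) blast
  let ?G = "(\<lambda>((a, b), (c, d)). ((a \<squnion> c) \<sqinter> d, (b \<squnion> c) \<sqinter> d)) ` (S \<times> T)"
  have "kappa_set \<kappa> (\<Union>p\<in>S. Pair p ` T)"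
    using S(2) T(2) by (intro kappa_set_UN[OF ok] kappa_set_image)
  moreover have "(\<Union>p\<in>S. Pair p ` T) = S \<times> T" by auto
  ultimately have "kappa_set \<kappa> ?G" by (simp add: kappa_set_image)
  moreover have "?G \<subseteq> carrier L \<times> carrier L"
  proof
    fix p assume "p \<in> ?G"
    then obtain a b c d where p: "(a, b) \<in> S" "(c, d) \<in> T"
      "p = ((a \<squnion> c) \<sqinter> d, (b \<squnion> c) \<sqinter> d)" by auto
    then have "a \<in> carrier L" "b \<in> carrier L" "c \<in> carrier L" "d \<in> carrier L"
      using S T by auto
    then show "p \<in> carrier L \<times> carrier L" using p(3) by simp
  qed
  moreover have "A \<inter> B = cong_gen \<kappa> L ?G"
    unfolding S(3) T(3) by (rule cong_gen_Int[OF S(1) T(1)]) (rule T_le)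
  ultimately show closed: "A \<inter> B \<in> carrier CL"
    by (simp add: CL_carrierI)
  show "A \<sqinter>\<^bsub>CL\<^esub> B = A \<inter> B"
    using assms closed unfolding cong_frame_def by (intro meet_inclusion_eq) simp_all
qed

lemma Id_in_CL: "Id_on (carrier L) \<in> carrier CL"
proof -
  have "cong_gen \<kappa> L {} = Id_on (carrier L)"
    using cong_gen_least[OF Id_congruence, of "{}"] kc_refl[OF cong_gen_cong[of "{}"]] by auto
  then show ?thesis
    using CL_carrierI[of "{}"] kappa_set_finite[OF ok, of "{}"] by simp
qed

lemma Id_subset_CL: "A \<in> carrier CL \<Longrightarrow> Id_on (carrier L) \<subseteq> A"
  using kc_refl[OF CL_congruence] by auto

lemma CL_bottom: "\<bottom>\<^bsub>CL\<^esub> = Id_on (carrier L)"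
  using Id_in_CL Id_subset_CL unfolding cong_frame_def by (intro bottom_inclusion_eqI) simp_all

lemma CL_join:
  assumes "A \<in> carrier CL" "B \<in> carrier CL"
  shows "A \<squnion>\<^bsub>CL\<^esub> B = cong_gen \<kappa> L (A \<union> B)"
  unfolding join_def using assms CL_sup_eq[of "{A, B}"] by (simp add: kappa_set_finite ok)

lemma CL_total: "kappa_congruence \<kappa> CL (carrier CL \<times> carrier CL)"
proof (rule kappa_congruenceI)
  fix S assume S: "S \<subseteq> carrier CL \<times> carrier CL" "kappa_set \<kappa> S"
  have "\<Squnion>\<^bsub>CL\<^esub>(f ` S) \<in> carrier CL" if "f ` S \<subseteq> carrier CL" for f
    using CL_sup_closed[OF that] CL_sup_eq[OF that] S(2) by (simp add: kappa_set_image)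
  moreover have "fst ` S \<subseteq> carrier CL" "snd ` S \<subseteq> carrier CL" using S(1) by auto
  ultimately show "(\<Squnion>\<^bsub>CL\<^esub>(fst ` S), \<Squnion>\<^bsub>CL\<^esub>(snd ` S)) \<in> carrier CL \<times> carrier CL"
    by simp
qed (auto simp: CL_meet_eq CL_Int_closed)

lemma principal_in_CL:
  "a \<in> carrier L \<Longrightarrow> b \<in> carrier L \<Longrightarrow> cong_gen \<kappa> L {(a, b)} \<in> carrier CL"
  by (rule CL_carrierI) (auto intro: kappa_set_finite ok)

lemma nabla_in_CL: "a \<in> carrier L \<Longrightarrow> nabla \<kappa> L a \<in> carrier CL"
  unfolding nabla_def by (rule principal_in_CL) auto

text \<open>
  In terms of complements, the congruence generated by \<open>(a, b)\<close> is the difference of \<open>\<nabla>\<^sub>b\<close> and \<open>\<nabla>\<^sub>a\<close>,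
  and collapsing \<open>\<nabla>\<^sub>b\<close> to \<open>\<nabla>\<^sub>a\<close> is the same as collapsing their difference to \<open>\<bottom>\<close>.
\<close>

lemma nabla_pair_iff_principal:
  assumes D: "kappa_congruence \<kappa> CL D"
    and a: "a \<in> carrier L" and b: "b \<in> carrier L" and le: "a \<sqsubseteq> b"
  shows "(nabla \<kappa> L a, nabla \<kappa> L b) \<in> D \<longleftrightarrow> (\<bottom>\<^bsub>CL\<^esub>, cong_gen \<kappa> L {(a, b)}) \<in> D"
proof
  let ?P = "cong_gen \<kappa> L {(a, b)}"
  note mem = nabla_in_CL[OF a] nabla_in_CL[OF b] principal_in_CL[OF a b]
  have join: "nabla \<kappa> L a \<squnion>\<^bsub>CL\<^esub> ?P = nabla \<kappa> L b"
    using mem by (simp add: CL_join nabla_eq_gen_Un[OF a b le, symmetric])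
  show "(\<bottom>\<^bsub>CL\<^esub>, ?P) \<in> D" if nab: "(nabla \<kappa> L a, nabla \<kappa> L b) \<in> D"
  proof -
    have "?P \<subseteq> nabla \<kappa> L b"
      using cong_gen_incl[of "nabla \<kappa> L a \<union> ?P" \<kappa> L] nabla_eq_gen_Un[OF a b le] by auto
    then have "nabla \<kappa> L b \<sqinter>\<^bsub>CL\<^esub> ?P = ?P"
      using mem by (simp add: CL_meet_eq Int_absorb1)
    moreover have "nabla \<kappa> L a \<sqinter>\<^bsub>CL\<^esub> ?P = \<bottom>\<^bsub>CL\<^esub>"
      using mem by (simp add: CL_meet_eq nabla_Int_principal[OF a b le] CL_bottom)
    ultimately show ?thesis
      using kc_meet[OF D nab kc_refl[OF D mem(3)]] by simp
  qed
  show "(nabla \<kappa> L a, nabla \<kappa> L b) \<in> D" if P: "(\<bottom>\<^bsub>CL\<^esub>, ?P) \<in> D"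
  proof -
    have "nabla \<kappa> L a \<squnion>\<^bsub>CL\<^esub> \<bottom>\<^bsub>CL\<^esub> = nabla \<kappa> L a"
      using mem Id_in_CL Id_subset_CL[OF mem(1)] CL_congruence[OF mem(1)]
      by (simp add: CL_join CL_bottom Un_absorb2 cong_gen_id)
    then show ?thesis
      using kc_join[OF ok D kc_refl[OF D mem(1)] P] join by simp
  qed
qed

text \<open>
  The congruence generated by \<open>S\<close> is the \<open>\<kappa>\<close>-join of the principal congruences of the members of \<open>S\<close>.
\<close>

lemma bottom_pair_if_generators:
  assumes D: "kappa_congruence \<kappa> CL D"
    and S: "S \<subseteq> carrier L \<times> carrier L" "kappa_set \<kappa> S"
    and gen: "\<And>p. p \<in> S \<Longrightarrow> (\<bottom>\<^bsub>CL\<^esub>, cong_gen \<kappa> L {p}) \<in> D"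
  shows "(\<bottom>\<^bsub>CL\<^esub>, cong_gen \<kappa> L S) \<in> D"
proof -
  let ?R = "(\<lambda>p. (\<bottom>\<^bsub>CL\<^esub>, cong_gen \<kappa> L {p})) ` S"
  have "?R \<subseteq> D" using gen by auto
  moreover have R: "kappa_set \<kappa> ?R" using S(2) by (rule kappa_set_image)
  ultimately have R_sup: "(\<Squnion>\<^bsub>CL\<^esub>(fst ` ?R), \<Squnion>\<^bsub>CL\<^esub>(snd ` ?R)) \<in> D"
    by (rule kc_sup[OF D])
  have F: "fst ` ?R \<subseteq> {\<bottom>\<^bsub>CL\<^esub>}" by auto
  have "\<Squnion>\<^bsub>CL\<^esub>(fst ` ?R) = cong_gen \<kappa> L (\<Union>(fst ` ?R))"
    using F Id_in_CL R by (intro CL_sup_eq) (auto simp: CL_bottom intro: kappa_set_image)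
  also have "\<dots> = \<bottom>\<^bsub>CL\<^esub>"
  proof (rule subset_antisym)
    have sub: "\<Union>(fst ` ?R) \<subseteq> Id_on (carrier L)" using F by (auto simp: CL_bottom)
    then show "cong_gen \<kappa> L (\<Union>(fst ` ?R)) \<subseteq> \<bottom>\<^bsub>CL\<^esub>"
      unfolding CL_bottom by (rule cong_gen_least[OF Id_congruence])
    have "\<Union>(fst ` ?R) \<subseteq> carrier L \<times> carrier L"
      by (rule subset_trans[OF sub]) auto
    from kc_refl[OF cong_gen_cong[OF this]]
    show "\<bottom>\<^bsub>CL\<^esub> \<subseteq> cong_gen \<kappa> L (\<Union>(fst ` ?R))"
      unfolding CL_bottom Id_on_def by blast
  qed
  finally have bot: "\<Squnion>\<^bsub>CL\<^esub>(fst ` ?R) = \<bottom>\<^bsub>CL\<^esub>" .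
  have "snd ` ?R \<subseteq> carrier CL"
    using S(1) principal_in_CL by auto
  then have "\<Squnion>\<^bsub>CL\<^esub>(snd ` ?R) = cong_gen \<kappa> L (\<Union>(snd ` ?R))"
    using S(2) by (intro CL_sup_eq kappa_set_image)
  also have "\<dots> = cong_gen \<kappa> L S"
  proof (rule subset_antisym)
    have "p \<in> \<Union>(snd ` ?R)" if "p \<in> S" for p
    proof (rule UnionI)
      show "cong_gen \<kappa> L {p} \<in> snd ` ?R"
        unfolding image_image snd_conv using that by (rule imageI)
      show "p \<in> cong_gen \<kappa> L {p}"
        using cong_gen_incl[of "{p}" \<kappa> L] by simp
    qed
    then show "cong_gen \<kappa> L S \<subseteq> cong_gen \<kappa> L (\<Union>(snd ` ?R))"
      by (intro cong_gen_mono subsetI)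
    have "cong_gen \<kappa> L {p} \<subseteq> cong_gen \<kappa> L S" if "p \<in> S" for p
      using that cong_gen_incl[of S \<kappa> L] by (intro cong_gen_least[OF cong_gen_cong[OF S(1)]]) auto
    then show "cong_gen \<kappa> L (\<Union>(snd ` ?R)) \<subseteq> cong_gen \<kappa> L S"
      by (intro cong_gen_least[OF cong_gen_cong[OF S(1)]]) auto
  qed
  finally show ?thesis using R_sup bot by simp
qed

lemma nabla_join:
  assumes a: "a \<in> carrier L" and b: "b \<in> carrier L"
  shows "nabla \<kappa> L (a \<squnion> b) = nabla \<kappa> L a \<squnion>\<^bsub>CL\<^esub> nabla \<kappa> L b"
  unfolding CL_join[OF nabla_in_CL[OF a] nabla_in_CL[OF b]]
proof (rule subset_antisym)
  note na = CL_congruence[OF nabla_in_CL[OF a]] and nb = CL_congruence[OF nabla_in_CL[OF b]]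
  have mem: "(\<bottom>, x) \<in> nabla \<kappa> L x" for x
    using cong_gen_incl[of "{(\<bottom>, x)}" \<kappa> L] by (simp add: nabla_def)
  have "nabla \<kappa> L a \<union> nabla \<kappa> L b \<subseteq> carrier L \<times> carrier L"
    using kc_carrier[OF na] kc_carrier[OF nb] by auto
  note u = cong_gen_cong[OF this]
  have "(\<bottom> \<squnion> \<bottom>, a \<squnion> b) \<in> cong_gen \<kappa> L (nabla \<kappa> L a \<union> nabla \<kappa> L b)"
    using mem cong_gen_incl[of "nabla \<kappa> L a \<union> nabla \<kappa> L b" \<kappa> L] by (intro kc_join[OF ok u]) auto
  then show "nabla \<kappa> L (a \<squnion> b) \<subseteq> cong_gen \<kappa> L (nabla \<kappa> L a \<union> nabla \<kappa> L b)"
    unfolding nabla_def[of \<kappa> L "a \<squnion> b"] by (intro cong_gen_least[OF u]) (simp add: absorb_le)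
  have "nabla \<kappa> L x \<subseteq> nabla \<kappa> L (a \<squnion> b)" if "x \<in> {a, b}" for x
  proof -
    have x: "x \<in> carrier L" "x \<sqsubseteq> a \<squnion> b"
      using that a b by (auto simp: join_left join_right)
    then show ?thesis
      using nabla_eq_gen_Un[of x "a \<squnion> b"] a b
        cong_gen_incl[of "nabla \<kappa> L x \<union> cong_gen \<kappa> L {(x, a \<squnion> b)}" \<kappa> L] by simp
  qed
  then show "cong_gen \<kappa> L (nabla \<kappa> L a \<union> nabla \<kappa> L b) \<subseteq> nabla \<kappa> L (a \<squnion> b)"
    using a b by (intro cong_gen_least[OF CL_congruence[OF nabla_in_CL]]) simp_all
qed

theorem gen_closure_eq_gen_nabla_pairs:
  assumes K: "kappa_congruence \<kappa> CL K"
  shows "gen_closure \<kappa> CL K = cong_gen \<kappa> CL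
    {(nabla \<kappa> L a, nabla \<kappa> L b) | a b.
      a \<in> carrier L \<and> b \<in> carrier L \<and> (nabla \<kappa> L a, nabla \<kappa> L b) \<in> K}"
    (is "_ = cong_gen \<kappa> CL ?T")
proof -
  let ?B = "{(\<bottom>\<^bsub>CL\<^esub>, A) | A. (\<bottom>\<^bsub>CL\<^esub>, A) \<in> K}"
  have bot: "\<bottom>\<^bsub>CL\<^esub> \<in> carrier CL"
    by (simp add: CL_bottom Id_in_CL)
  have CB: "kappa_congruence \<kappa> CL (cong_gen \<kappa> CL ?B)"
    using kc_carrier[OF K] by (intro cong_gen_congruence[OF CL_total]) auto
  have CT: "kappa_congruence \<kappa> CL (cong_gen \<kappa> CL ?T)"
    by (intro cong_gen_congruence[OF CL_total]) (auto simp: nabla_in_CL)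
  have "?B \<subseteq> cong_gen \<kappa> CL ?T"
  proof clarify
    fix A assume A: "(\<bottom>\<^bsub>CL\<^esub>, A) \<in> K"
    then have A_mem: "A \<in> carrier CL" using kc_carrier[OF K] by auto
    then obtain S where S: "S \<subseteq> carrier L \<times> carrier L" "kappa_set \<kappa> S" "A = cong_gen \<kappa> L S"
      and S_le: "\<And>a b. (a, b) \<in> S \<Longrightarrow> a \<sqsubseteq> b"
      by (rule CL_ordered_generators) blast
    have "(\<bottom>\<^bsub>CL\<^esub>, cong_gen \<kappa> L {p}) \<in> cong_gen \<kappa> CL ?T" if p: "p \<in> S" for p
    proof -
      obtain a b where ab: "p = (a, b)" by (cases p)
      have a: "a \<in> carrier L" and b: "b \<in> carrier L" and le: "a \<sqsubseteq> b"
        using p S(1) S_le unfolding ab by auto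
      note P = principal_in_CL[OF a b]
      have "cong_gen \<kappa> L {(a, b)} \<subseteq> A"
        using p cong_gen_incl[of S \<kappa> L] unfolding S(3) ab
        by (intro cong_gen_least[OF cong_gen_cong[OF S(1)]]) auto
      then have "A \<sqinter>\<^bsub>CL\<^esub> cong_gen \<kappa> L {(a, b)} = cong_gen \<kappa> L {(a, b)}"
        using A_mem P by (simp add: CL_meet_eq Int_absorb1)
      moreover have "\<bottom>\<^bsub>CL\<^esub> \<sqinter>\<^bsub>CL\<^esub> cong_gen \<kappa> L {(a, b)} = \<bottom>\<^bsub>CL\<^esub>"
        using P Id_in_CL Id_subset_CL[OF P] by (simp add: CL_meet_eq CL_bottom Int_absorb2)
      ultimately have "(\<bottom>\<^bsub>CL\<^esub>, cong_gen \<kappa> L {(a, b)}) \<in> K"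
        using kc_meet[OF K A kc_refl[OF K P]] by simp
      then have "(nabla \<kappa> L a, nabla \<kappa> L b) \<in> K"
        using nabla_pair_iff_principal[OF K a b le] by simp
      then have "(nabla \<kappa> L a, nabla \<kappa> L b) \<in> cong_gen \<kappa> CL ?T"
        using a b by (intro set_mp[OF cong_gen_incl]) blast
      then show ?thesis
        using nabla_pair_iff_principal[OF CT a b le] unfolding ab by simp
    qed
    then show "(\<bottom>\<^bsub>CL\<^esub>, A) \<in> cong_gen \<kappa> CL ?T"
      unfolding S(3) by (rule bottom_pair_if_generators[OF CT S(1,2)])
  qed
  moreover have "?T \<subseteq> cong_gen \<kappa> CL ?B"
  proof clarify
    fix a b assume a: "a \<in> carrier L" and b: "b \<in> carrier L"
      and ab: "(nabla \<kappa> L a, nabla \<kappa> L b) \<in> K"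
    have step: "(nabla \<kappa> L x, nabla \<kappa> L (x \<squnion> y)) \<in> cong_gen \<kappa> CL ?B"
      if x: "x \<in> carrier L" and y: "y \<in> carrier L" and xy: "(nabla \<kappa> L x, nabla \<kappa> L y) \<in> K" for x y
    proof -
      have xj: "x \<squnion> y \<in> carrier L" "x \<sqsubseteq> x \<squnion> y"
        using x y by (auto simp: join_left)
      have "nabla \<kappa> L x \<squnion>\<^bsub>CL\<^esub> nabla \<kappa> L x = nabla \<kappa> L x"
        using x by (simp add: nabla_join[symmetric] absorb_le)
      then have "(nabla \<kappa> L x, nabla \<kappa> L (x \<squnion> y)) \<in> K"
        using kc_join[OF ok K kc_refl[OF K nabla_in_CL[OF x]] xy] nabla_join[OF x y] by simp
      then have "(\<bottom>\<^bsub>CL\<^esub>, cong_gen \<kappa> L {(x, x \<squnion> y)}) \<in> K"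
        using nabla_pair_iff_principal[OF K x xj] by simp
      then have "(\<bottom>\<^bsub>CL\<^esub>, cong_gen \<kappa> L {(x, x \<squnion> y)}) \<in> cong_gen \<kappa> CL ?B"
        by (intro set_mp[OF cong_gen_incl]) blast
      then show ?thesis
        using nabla_pair_iff_principal[OF CB x xj] by simp
    qed
    have "(nabla \<kappa> L b, nabla \<kappa> L (a \<squnion> b)) \<in> cong_gen \<kappa> CL ?B"
      using step[OF b a kc_sym[OF K ab]] by (simp add: join_comm[of L b a])
    then show "(nabla \<kappa> L a, nabla \<kappa> L b) \<in> cong_gen \<kappa> CL ?B"
      by (intro kc_trans[OF CB step[OF a b ab] kc_sym[OF CB]])
  qed
  ultimately show ?thesis
    unfolding gen_closure_eq_cong_gen[OF CL_total bot K]
    by (intro subset_antisym cong_gen_least CB CT)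
qed

end

theorem mainTheorem6:
  fixes \<kappa> :: "'k kappa"
    and L :: "'a gorder"
    and M :: "'b gorder"
    and \<phi> :: "'a rel \<Rightarrow> 'b"
  assumes "kappa_ok \<kappa>"
    and "kappa_frame \<kappa> L"
    and "kappa_frame \<kappa> M"
    and "kappa_hom \<kappa> (cong_frame \<kappa> L) M \<phi>"
  shows "gen_closure \<kappa> (cong_frame \<kappa> L) (hom_kernel (cong_frame \<kappa> L) \<phi>) =
         nabla_tilde \<kappa> L (hom_kernel L (\<phi> \<circ> nabla \<kappa> L))"
proof -
  interpret regular_kappa_frame \<kappa> L
    using assms(1,2) by (intro regular_kappa_frame.intro regular_kappa_frame_axioms.intro)
  have "a \<in> carrier L \<and> b \<in> carrier L \<and>
      (nabla \<kappa> L a, nabla \<kappa> L b) \<in> hom_kernel (cong_frame \<kappa> L) \<phi> \<longleftrightarrow>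
    (a, b) \<in> hom_kernel L (\<phi> \<circ> nabla \<kappa> L)" for a b
    by (auto simp: hom_kernel_def nabla_in_CL)
  then show ?thesis
    unfolding nabla_tilde_def
    using gen_closure_eq_gen_nabla_pairs[OF hom_kernel_congruence[OF CL_total assms(4)]] by simp
qed

end
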